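(* Let $p$ be an odd prime. There is a sequence $J$ of elements of $Z_p^3$ with $|J|=4p-4+\frac{p-1}{2}$ such that $N^{2p}(I)\equiv 0 \pmod p$ for every subsequence $I\subset J$ with $|I|=4p-3$, and such that $J$ does not have any subsequence of length $p$ whose sum is $0$ modulo $p$.
   Context: $Z_p=\mathbb{Z}/p\mathbb{Z}$. A sequence in $Z_p^3$ is a finite sequence of elements in which repetitions are allowed and order is irrelevant; $|J|$ denotes its length (counted with multiplicity). A subsequence of $J$ is obtained by choosing a subset of the indices of $J$. For a sequence $I$ in $Z_p^3$ and an integer $k\ge 1$, $N^{kp}(I)$ is the number of subsequences of $I$ of length $kp$ (counted as subsets of the index set) whose sum is $0$ in $Z_p^3$. *)

theory Defs
  imports "HOL-Algebra.Elementary_Groups" "HOL-Algebra.FiniteProduct" "HOL-Number_Theory.Cong" "HOL-Computational_Algebra.Primes"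
begin

definition Zp3 :: "nat \<Rightarrow> (int \<times> int \<times> int) monoid" where
  "Zp3 p = integer_mod_group p \<times>\<times> integer_mod_group p \<times>\<times> integer_mod_group p"

lemma comm_group_Zp3: "comm_group (Zp3 p)"
proof -
  have prod: "comm_group (G \<times>\<times> H)" if "comm_group G" "comm_group H"
    for G :: "int monoid" and H :: "'h monoid"
  proof -
    interpret G: comm_group G by fact
    interpret H: comm_group H by fact
    interpret GH: group "G \<times>\<times> H"
      by (rule DirProd_group) (rule G.is_group H.is_group)+
    show ?thesis
      by (rule GH.group_comm_groupI) (auto simp: G.m_comm H.m_comm)
  qed
  show ?thesis
    unfolding Zp3_def by (intro prod abelian_integer_mod_group)
qed

text \<open>
  A sequence is a family \<open>J\<close> restricted to a finite index set \<open>A\<close>, so that its length is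
  \<open>card A\<close> and its subsequences correspond to the subsets of \<open>A\<close>. The group \<open>Zp3 p\<close> is written
  multiplicatively in the library, hence the sum of a subsequence is a \<^const>\<open>finprod\<close>.
\<close>

definition zero_sum :: "nat \<Rightarrow> ('i \<Rightarrow> int \<times> int \<times> int) \<Rightarrow> 'i set \<Rightarrow> bool" where
  "zero_sum p J S \<longleftrightarrow> finprod (Zp3 p) J S = \<one>\<^bsub>Zp3 p\<^esub>"

text \<open>\<open>zero_sum_count p k J A\<close> is $N^{kp}(I)$ for the sequence $I = (J_i)_{i \in A}$.\<close>

definition zero_sum_count :: "nat \<Rightarrow> nat \<Rightarrow> ('i \<Rightarrow> int \<times> int \<times> int) \<Rightarrow> 'i set \<Rightarrow> nat" where
  "zero_sum_count p k J A = card {S. S \<subseteq> A \<and> card S = k * p \<and> zero_sum p J S}"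

end

theory Submission
  imports Defs
begin

text \<open>
  Take \<open>0\<close>, \<open>e\<^sub>1\<close>, \<open>e\<^sub>2\<close>, \<open>e\<^sub>3\<close> with multiplicity \<open>p - 1\<close> each and \<open>(1, 1, 1)\<close> with multiplicity
  \<open>(p - 1) / 2\<close>. A zero-sum subsequence that uses \<open>(1, 1, 1)\<close> exactly \<open>b > 0\<close> times must use every
  \<open>e\<^sub>i\<close> exactly \<open>p - b\<close> times, so its length is at least \<open>3 p - 2 b > 2 p\<close>; for \<open>b = 0\<close> it uses only
  \<open>0\<close>, so its length is less than \<open>p\<close>. Hence no zero-sum subsequence has length \<open>p\<close>
  or \<open>2 p\<close>, and all the counts in question vanish.
\<close>

lemma carrier_Zp3:
  assumes "p > 0"
  shows "carrier (Zp3 p) = {0..<int p} \<times> {0..<int p} \<times> {0..<int p}"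
  using assms by (simp add: Zp3_def carrier_integer_mod_group)

lemma one_Zp3: "\<one>\<^bsub>Zp3 p\<^esub> = (0, 0, 0)"
  by (simp add: Zp3_def)

lemma mult_Zp3:
  "(x, y, z) \<otimes>\<^bsub>Zp3 p\<^esub> (x', y', z') =
     ((x + x') mod int p, (y + y') mod int p, (z + z') mod int p)"
  by (simp add: Zp3_def mult_integer_mod_group)

text \<open>The group operation is componentwise addition mod \<open>p\<close>, so by induction the
  reduction can be postponed to the end. This replaces group products by integer sums.\<close>

lemma finprod_Zp3:
  assumes "finite S" and "J \<in> S \<rightarrow> carrier (Zp3 p)"
  shows "finprod (Zp3 p) J S =
    ((\<Sum>i\<in>S. fst (J i)) mod int p,
     (\<Sum>i\<in>S. fst (snd (J i))) mod int p,
     (\<Sum>i\<in>S. snd (snd (J i))) mod int p)"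
  using assms
proof (induction S rule: finite_induct)
  case empty
  then show ?case
    by (simp add: comm_monoid.finprod_empty[OF comm_group.axioms(1)[OF comm_group_Zp3]] one_Zp3)
next
  case (insert i S)
  interpret comm_group "Zp3 p" by (rule comm_group_Zp3)
  obtain x y z where xyz: "J i = (x, y, z)" by (cases "J i") auto
  show ?case
    using insert by (simp add: Pi_iff xyz mult_Zp3 mod_add_right_eq)
qed

lemma zero_sum_iff:
  assumes "finite S" and "J \<in> S \<rightarrow> carrier (Zp3 p)"
  shows "zero_sum p J S \<longleftrightarrow>
    int p dvd (\<Sum>i\<in>S. fst (J i)) \<and>
    int p dvd (\<Sum>i\<in>S. fst (snd (J i))) \<and>
    int p dvd (\<Sum>i\<in>S. snd (snd (J i)))"
  by (simp add: zero_sum_def finprod_Zp3[OF assms] one_Zp3 dvd_eq_mod_eq_0)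

text \<open>Labels 0 to 4 stand for 0, the three unit vectors and (1, 1, 1). Coordinate
  \<open>j\<close> is thus 1 exactly at the labels \<open>j\<close> and 4.\<close>

definition five_points :: "nat \<Rightarrow> int \<times> int \<times> int" where
  "five_points k = (of_bool (k \<in> {1, 4}), of_bool (k \<in> {2, 4}), of_bool (k \<in> {3, 4}))"

text \<open>Fibres over distinct labels are disjoint. With \<open>k = 4\<close> this expresses a
  coordinate sum through multiplicities.\<close>

lemma sum_of_bool_fibres:
  assumes "finite S" and "j \<noteq> k"
  shows "(\<Sum>i\<in>S. of_bool (f i \<in> {j, k}) :: int) =
    int (card {i \<in> S. f i = j} + card {i \<in> S. f i = k})"
proof -
  have "(\<Sum>i\<in>S. of_bool (f i \<in> {j, k}) :: int) = int (card {i \<in> S. f i \<in> {j, k}})"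
    using assms(1) by (simp add: of_bool_def sum.If_cases Int_def)
  also have "{i \<in> S. f i \<in> {j, k}} = {i \<in> S. f i = j} \<union> {i \<in> S. f i = k}"
    by auto
  also have "card \<dots> = card {i \<in> S. f i = j} + card {i \<in> S. f i = k}"
    using assms by (intro card_Un_disjoint) auto
  finally show ?thesis .
qed

text \<open>The sum is below \<open>2 * p\<close>, and the only multiples of \<open>p\<close> there
  are 0 and \<open>p\<close>.\<close>

lemma dvd_add_cases:
  fixes p a b :: nat
  assumes "p dvd a + b" and "a < p" and "b < p"
  shows "a + b = 0 \<or> a + b = p"
proof -
  obtain k where k: "a + b = p * k" using assms(1) by (elim dvdE)
  have "p * k < p * 2" using k assms(2,3) by linarith
  then have "k < 2" by simp
  then have "k = 0 \<or> k = 1" by linarith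
  then show ?thesis using k by auto
qed

lemma zero_sum_five_points_length:
  fixes f :: "'i \<Rightarrow> nat"
  assumes "p > 1" and "finite S" and "f ` S \<subseteq> {..<5}"
    and small: "\<And>k. card {i \<in> S. f i = k} < p"
    and half: "2 * card {i \<in> S. f i = 4} < p"
    and zero: "zero_sum p (five_points \<circ> f) S"
  shows "card S < p \<or> 2 * p < card S"
proof -
  define a where "a k = card {i \<in> S. f i = k}" for k
  have "card S = (\<Sum>k<5. a k)"
    \<comment> \<open>Summing the constant 1 over the fibres of \<open>f\<close> counts
      \<open>S\<close>.\<close>
    unfolding a_def using sum.group[OF assms(2) finite_lessThan assms(3), of "\<lambda>_. 1 :: nat"] by simp
  then have card_S: "card S = a 0 + a 1 + a 2 + a 3 + a 4"
    by (simp add: eval_nat_numeral)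
  have carrier: "five_points \<circ> f \<in> S \<rightarrow> carrier (Zp3 p)"
    using assms(1) by (auto simp: carrier_Zp3 five_points_def)
  have "a j + a 4 = 0 \<or> a j + a 4 = p" if "j \<in> {1, 2, 3}" for j
  proof (rule dvd_add_cases)
    have "int p dvd (\<Sum>i\<in>S. of_bool (f i \<in> {j, 4}))"
      using zero that unfolding zero_sum_iff[OF assms(2) carrier] by (auto simp: five_points_def)
    then have "int p dvd int (a j + a 4)"
      using that sum_of_bool_fibres[OF assms(2), of j 4 f] unfolding a_def by auto
    then show "p dvd a j + a 4"
      by (simp only: int_dvd_int_iff)
  qed (use small in \<open>simp_all add: a_def\<close>)
  then have sums: "a 1 + a 4 = 0 \<or> a 1 + a 4 = p" "a 2 + a 4 = 0 \<or> a 2 + a 4 = p"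
    "a 3 + a 4 = 0 \<or> a 3 + a 4 = p"
    by blast+
  have bounds: "a 0 < p" "2 * a 4 < p"
    using small half by (simp_all add: a_def)
  show ?thesis
  proof (cases "a 4 = 0")
    case True
    \<comment> \<open>The alternative \<open>a j = p\<close> contradicts \<open>small\<close>, so
      only the point 0 remains.\<close>
    then have "a 1 = 0" "a 2 = 0" "a 3 = 0"
      using sums small[of 1] small[of 2] small[of 3] unfolding a_def by linarith+
    then show ?thesis using True card_S bounds by simp
  next
    case False
    then have "a 1 + a 4 = p" "a 2 + a 4 = p" "a 3 + a 4 = p"
      using sums by simp_all
    \<comment> \<open>Here \<open>card S = a 0 + 3 * p - 2 * a 4\<close>, and
      \<open>2 * a 4 < p\<close>.\<close>
    then show ?thesis using card_S bounds by linarith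
  qed
qed

lemma card_div_fibre:
  fixes d k :: nat
  assumes "d > 0" and "finite S"
  shows "card {i \<in> S. i div d = k} \<le> d"
proof -
  have "{i \<in> S. i div d = k} \<subseteq> {k * d..<k * d + d}"
    using dividend_less_div_times[OF assms(1)] by (auto simp: add.commute)
  from card_mono[OF _ this] show ?thesis by simp
qed

theorem theorem2:
  fixes p :: nat
  assumes "prime p" and "odd p"
  shows "\<exists>(J :: nat \<Rightarrow> int \<times> int \<times> int) A.
           finite A \<and> J \<in> A \<rightarrow> carrier (Zp3 p) \<and>
           card A = 4 * p - 4 + (p - 1) div 2 \<and>
           (\<forall>I \<subseteq> A. card I = 4 * p - 3 \<longrightarrow> [zero_sum_count p 2 J I = 0] (mod p)) \<and>
           \<not> (\<exists>S \<subseteq> A. card S = p \<and> zero_sum p J S)"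
proof -
  define d where "d = p - 1"
  \<comment> \<open>Successive blocks of \<open>d\<close> indices carry the five points in turn;
    \<open>A\<close> ends after \<open>d div 2\<close> indices of block 4, that of (1, 1,
    1).\<close>
  define J where "J = five_points \<circ> (\<lambda>i. i div d)"
  define A where "A = {..<4 * d + d div 2}"
  have p: "p > 1" using assms(1) by (rule prime_gt_1_nat)
  then have d: "d > 0" and p_eq: "p = d + 1" by (simp_all add: d_def)
  have len: "card S < p \<or> 2 * p < card S" if S: "S \<subseteq> A" and zero: "zero_sum p J S" for S
  proof (rule zero_sum_five_points_length[OF p])
    show fin: "finite S" using S by (auto simp: A_def intro: finite_subset)
    show "(\<lambda>i. i div d) ` S \<subseteq> {..<5}"
      using S d by (auto simp: A_def less_mult_imp_div_less dest!: subsetD)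
    show "card {i \<in> S. i div d = k} < p" for k
      using card_div_fibre[OF d fin, of k] p_eq by simp
    have "{i \<in> S. i div d = 4} \<subseteq> {4 * d..<4 * d + d div 2}"
    proof
      fix i assume i: "i \<in> {i \<in> S. i div d = 4}"
      then have "4 * d \<le> i"
        using div_times_less_eq_dividend[of i d] by (metis (lifting) mem_Collect_eq)
      moreover have "i < 4 * d + d div 2"
        using S i unfolding A_def by blast
      ultimately show "i \<in> {4 * d..<4 * d + d div 2}" by simp
    qed
    \<comment> \<open>The truncated last block gives
      \<open>2 * (d div 2) \<le> d < p\<close>.\<close>
    from card_mono[OF _ this] show "2 * card {i \<in> S. i div d = 4} < p"
      using p_eq by simp
    show "zero_sum p (five_points \<circ> (\<lambda>i. i div d)) S" using zero by (simp add: J_def)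
  qed
  have "J \<in> A \<rightarrow> carrier (Zp3 p)"
    using p by (auto simp: J_def carrier_Zp3 five_points_def)
  moreover have "card A = 4 * p - 4 + (p - 1) div 2"
    by (simp add: A_def d_def)
  \<comment> \<open>The congruence holds because the count itself is 0: \<open>len\<close> excludes
    the length \<open>2 * p\<close>.\<close>
  moreover have "zero_sum_count p 2 J I = 0" if "I \<subseteq> A" for I
  proof -
    have none: "{S. S \<subseteq> I \<and> card S = 2 * p \<and> zero_sum p J S} = {}"
    proof (intro equals0I)
      fix S assume "S \<in> {S. S \<subseteq> I \<and> card S = 2 * p \<and> zero_sum p J S}"
      then show False using len[of S] that by auto
    qed
    show ?thesis unfolding zero_sum_count_def none by simp
  qed
  moreover have "\<not> (\<exists>S \<subseteq> A. card S = p \<and> zero_sum p J S)"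
    using len by (metis less_irrefl less_add_same_cancel1 mult_2 not_less_iff_gr_or_eq less_nat_zero_code)
  ultimately show ?thesis
    by (intro exI[of _ J] exI[of _ A]) (simp add: A_def)
qed

end
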